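(* Let $F_2$ be the free group with free generators $u_A,u_B$, and define elements $W_{A,n},W_{B,n}\in F_2$ for $n\ge 1$ recursively by $$W_{A,1}(u_A,u_B)=u_Bu_A,\qquad W_{B,1}(u_A,u_B)=u_Au_B,$$ and, for $n\ge 2$, $$W_{A,n}(u_A,u_B)=W_{A,n-1}\big([u_B,u_A],[u_A^{-1},u_B^{-1}]\big),\qquad W_{B,n}(u_A,u_B)=W_{B,n-1}\big([u_B,u_A],[u_A^{-1},u_B^{-1}]\big).$$ Let $n\ge 1$ and let $G$ be a solvable group whose derived series has length at most $n$. Then the words $W_A=W_{A,n}$ and $W_B=W_{B,n}$ satisfy the following two conditions with $G_A=G_B=G$: (W1) they can be written in the form $$W_A=u_A^{a_{1,1}}u_B^{b_{1,1}}\cdots u_A^{a_{1,m_1}},\qquad W_B=u_B^{b_{2,1}}u_A^{a_{2,1}}\cdots u_B^{b_{2,m_2}}$$ with $m_1,m_2\in\mathbb{N}$, $a_{i,j},b_{i,j}\in\mathbb{Z}$ for all $i,j$, and $a_{1,m_1}\ne 0$, $b_{2,m_2}\ne 0$; (W2) $W_A(g_A,g_B)=W_B(g_A,g_B)$ for all $(g_A,g_B)\in G_A\times G_B$.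
   Context: The commutator is $[g,h]=g^{-1}h^{-1}gh$. For $W\in F_2$ and elements $x,y$ of a group, $W(x,y)$ denotes the image of $W$ under the homomorphism sending $u_A\mapsto x$, $u_B\mapsto y$. In (W1) the exponents other than the last ones are arbitrary integers (zero is allowed). The derived series of $G$ is $G\ge G'=[G,G]\ge G''\ge\cdots$; length at most $1$ means that $G$ is abelian. *)

theory Defs
  imports "HOL-Algebra.Solvable_Groups"
begin

subsection \<open>Free groups, realised by reduced words\<close>

text \<open>The letter \<open>(x, True)\<close> stands for the generator \<open>x\<close>, and \<open>(x, False)\<close> for its
  inverse.\<close>

type_synonym 'a letter = "'a \<times> bool"

definition inv_letter :: "'a letter \<Rightarrow> 'a letter" where
  "inv_letter a = (fst a, \<not> snd a)"

fun reduced :: "'a letter list \<Rightarrow> bool" where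
  "reduced (a # b # w) \<longleftrightarrow> b \<noteq> inv_letter a \<and> reduced (b # w)"
| "reduced w \<longleftrightarrow> True"

fun cons_reduce :: "'a letter \<Rightarrow> 'a letter list \<Rightarrow> 'a letter list" where
  "cons_reduce a [] = [a]"
| "cons_reduce a (b # w) = (if b = inv_letter a then w else a # b # w)"

definition free_group :: "'a letter list monoid" where
  "free_group = \<lparr>carrier = {w. reduced w}, mult = foldr cons_reduce, one = []\<rparr>"

definition free_gen :: "'a \<Rightarrow> 'a letter list" where
  "free_gen x = [(x, True)]"

text \<open>The homomorphism from the free group to \<open>H\<close> that extends \<open>f\<close>; see \<open>free_lift_hom\<close>,
  \<open>free_lift_gen\<close> and \<open>free_lift_unique\<close> below.\<close>

definition free_lift :: "('h, 'b) monoid_scheme \<Rightarrow> ('a \<Rightarrow> 'h) \<Rightarrow> 'a letter list \<Rightarrow> 'h" where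
  "free_lift H f w =
     foldr (\<lambda>(x, e) h. (if e then f x else inv\<^bsub>H\<^esub> (f x)) \<otimes>\<^bsub>H\<^esub> h) w \<one>\<^bsub>H\<^esub>"

lemma inv_letter_inv [simp]: "inv_letter (inv_letter a) = a"
  by (simp add: inv_letter_def)

lemma inv_letter_neq [simp]: "inv_letter a \<noteq> a" "a \<noteq> inv_letter a"
  by (cases a, simp add: inv_letter_def)+

lemma reduced_tl: "reduced (a # w) \<Longrightarrow> reduced w"
  by (cases w) auto

lemma reduced_cons_reduce: "reduced w \<Longrightarrow> reduced (cons_reduce a w)"
  by (cases w) (auto dest: reduced_tl)

lemma cons_reduce_inv: "reduced w \<Longrightarrow> cons_reduce a (cons_reduce (inv_letter a) w) = w"
  by (cases w rule: reduced.cases) auto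

lemma reduced_foldr: "reduced w \<Longrightarrow> reduced (foldr cons_reduce v w)"
  by (induction v) (auto intro: reduced_cons_reduce)

lemma foldr_cons_reduce:
  assumes "reduced z"
  shows "foldr cons_reduce (cons_reduce a v) z = cons_reduce a (foldr cons_reduce v z)"
proof (cases v)
  case (Cons b w)
  then show ?thesis
    using cons_reduce_inv[OF reduced_foldr[OF assms], of a w] by auto
qed simp

lemma foldr_cons_reduce_assoc:
  assumes "reduced z"
  shows "foldr cons_reduce (foldr cons_reduce v w) z
       = foldr cons_reduce v (foldr cons_reduce w z)"
  by (induction v) (simp_all add: foldr_cons_reduce[OF assms])

lemma foldr_cons_reduce_Nil: "reduced w \<Longrightarrow> foldr cons_reduce w [] = w"
  by (induction w rule: reduced.induct) auto

lemma foldr_cons_reduce_inverse: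
  "reduced w \<Longrightarrow> foldr cons_reduce (rev (map inv_letter v)) (foldr cons_reduce v w) = w"
proof (induction v arbitrary: w)
  case (Cons a v)
  have "cons_reduce (inv_letter a) (cons_reduce a (foldr cons_reduce v w))
      = foldr cons_reduce v w"
    using cons_reduce_inv[OF reduced_foldr[OF Cons.prems], of "inv_letter a" v] by simp
  then show ?case
    using Cons by simp
qed simp

lemma group_free_group: "group (free_group :: 'a letter list monoid)"
proof (rule groupI)
  fix w :: "'a letter list"
  assume w: "w \<in> carrier free_group"
  define v where "v = foldr cons_reduce (rev (map inv_letter w)) []"
  have "reduced v"
    unfolding v_def by (rule reduced_foldr) simp
  moreover have "foldr cons_reduce v w = []"
    using w foldr_cons_reduce_assoc[of w "rev (map inv_letter w)" "[]"]
      foldr_cons_reduce_inverse[of "[]" w]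
    by (simp add: v_def free_group_def foldr_cons_reduce_Nil)
  ultimately show "\<exists>v\<in>carrier free_group. v \<otimes>\<^bsub>free_group\<^esub> w = \<one>\<^bsub>free_group\<^esub>"
    by (auto simp: free_group_def)
qed (auto simp: free_group_def reduced_foldr foldr_cons_reduce_assoc)

lemma free_gen_closed [simp]: "free_gen x \<in> carrier free_group"
  by (simp add: free_gen_def free_group_def)

lemma inv_free_gen: "inv\<^bsub>free_group\<^esub> (free_gen x) = [(x, False)]"
  by (rule group.inv_equality[OF group_free_group])
    (auto simp: free_gen_def free_group_def inv_letter_def)

lemma free_lift_closed:
  assumes "group H" "\<And>x. f x \<in> carrier H"
  shows "free_lift H f w \<in> carrier H"
proof -
  interpret group H by fact
  show ?thesis
    by (induction w) (auto simp: free_lift_def assms(2))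
qed

lemma free_lift_cons_reduce:
  assumes "group H" "\<And>x. f x \<in> carrier H"
  shows "free_lift H f (cons_reduce a w) = free_lift H f (a # w)"
proof -
  interpret group H by fact
  have cl: "free_lift H f v \<in> carrier H" for v
    by (rule free_lift_closed[OF assms])
  show ?thesis
  proof (cases w)
    case (Cons b v)
    show ?thesis
      using cl[of v] assms(2) unfolding Cons
      by (cases a) (auto simp: free_lift_def inv_letter_def m_assoc[symmetric])
  qed simp
qed

lemma free_lift_hom:
  assumes "group H" "\<And>x. f x \<in> carrier H"
  shows "free_lift H f \<in> hom free_group H"
proof -
  interpret group H by fact
  have cl: "free_lift H f v \<in> carrier H" for v
    by (rule free_lift_closed[OF assms])
  have "free_lift H f (foldr cons_reduce v w) = free_lift H f v \<otimes>\<^bsub>H\<^esub> free_lift H f w" for v w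
  proof (induction v)
    case Nil
    then show ?case using cl[of w] by (simp add: free_lift_def)
  next
    case (Cons a v)
    have "free_lift H f (foldr cons_reduce (a # v) w)
        = free_lift H f (a # foldr cons_reduce v w)"
      by (simp add: free_lift_cons_reduce[OF assms])
    also have "\<dots> = free_lift H f (a # v) \<otimes>\<^bsub>H\<^esub> free_lift H f w"
      using Cons cl[of v] cl[of w] assms(2)
      by (cases a) (auto simp: free_lift_def m_assoc)
    finally show ?case .
  qed
  then show ?thesis
    using cl by (auto simp: hom_def free_group_def)
qed

lemma free_lift_gen:
  assumes "group H" "\<And>x. f x \<in> carrier H"
  shows "free_lift H f (free_gen x) = f x"
proof -
  interpret group H by fact
  show ?thesis using assms(2) by (simp add: free_lift_def free_gen_def)
qed

lemma free_lift_unique: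
  assumes "group H" "h \<in> hom free_group H" "w \<in> carrier free_group"
  shows "h w = free_lift H (\<lambda>x. h (free_gen x)) w"
proof -
  interpret h: group_hom free_group H h
    using assms group_free_group by (simp add: group_hom_def group_hom_axioms_def)
  have "reduced w \<Longrightarrow> h w = free_lift H (\<lambda>x. h (free_gen x)) w"
  proof (induction w)
    case Nil
    then show ?case using h.hom_one by (simp add: free_lift_def free_group_def)
  next
    case (Cons a w)
    have red: "reduced w" using Cons.prems by (rule reduced_tl)
    have aw: "a # w = [a] \<otimes>\<^bsub>free_group\<^esub> w"
      using Cons.prems by (cases w) (auto simp: free_group_def)
    have "h (a # w) = h [a] \<otimes>\<^bsub>H\<^esub> h w"
      unfolding aw by (rule h.hom_mult) (use red in \<open>auto simp: free_group_def\<close>)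
    moreover have "h [(x, False)] = inv\<^bsub>H\<^esub> (h (free_gen x))" for x
      using h.hom_inv[of "free_gen x"] by (simp add: inv_free_gen)
    ultimately show ?case
      using Cons.IH[OF red] by (cases a) (auto simp: free_lift_def free_gen_def)
  qed
  then show ?thesis using assms(3) by (simp add: free_group_def)
qed


subsection \<open>Words in two letters\<close>

datatype gen2 = GenA | GenB

type_synonym word2 = "gen2 letter list"

abbreviation F2 :: "word2 monoid" where
  "F2 \<equiv> free_group"

abbreviation u_A :: word2 where
  "u_A \<equiv> free_gen GenA"

abbreviation u_B :: word2 where
  "u_B \<equiv> free_gen GenB"

text \<open>\<open>word_at G W x y\<close> is \<open>W(x, y)\<close>, computed in \<open>G\<close>.\<close>

definition word_at :: "('g, 'b) monoid_scheme \<Rightarrow> word2 \<Rightarrow> 'g \<Rightarrow> 'g \<Rightarrow> 'g" where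
  "word_at G W x y = free_lift G (case_gen2 x y) W"

text \<open>The convention here is \<open>[g, h] = g\<^sup>-\<^sup>1 h\<^sup>-\<^sup>1 g h\<close>.\<close>

definition commutator :: "('g, 'b) monoid_scheme \<Rightarrow> 'g \<Rightarrow> 'g \<Rightarrow> 'g" where
  "commutator G g h = inv\<^bsub>G\<^esub> g \<otimes>\<^bsub>G\<^esub> inv\<^bsub>G\<^esub> h \<otimes>\<^bsub>G\<^esub> g \<otimes>\<^bsub>G\<^esub> h"

text \<open>Both sequences start at index 1; the value at 0 is left unspecified.\<close>

fun W_A :: "nat \<Rightarrow> word2" where
  "W_A (Suc 0) = u_B \<otimes>\<^bsub>F2\<^esub> u_A"
| "W_A (Suc (Suc n)) =
     word_at F2 (W_A (Suc n))
       (commutator F2 u_B u_A) (commutator F2 (inv\<^bsub>F2\<^esub> u_A) (inv\<^bsub>F2\<^esub> u_B))"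

fun W_B :: "nat \<Rightarrow> word2" where
  "W_B (Suc 0) = u_A \<otimes>\<^bsub>F2\<^esub> u_B"
| "W_B (Suc (Suc n)) =
     word_at F2 (W_B (Suc n))
       (commutator F2 u_B u_A) (commutator F2 (inv\<^bsub>F2\<^esub> u_A) (inv\<^bsub>F2\<^esub> u_B))"

text \<open>\<open>alternating_product G x y a b m\<close> is the product
  \<open>x\<^bsup>a 1\<^esup> y\<^bsup>b 1\<^esup> \<dots> x\<^bsup>a (m-1)\<^esup> y\<^bsup>b (m-1)\<^esup> x\<^bsup>a m\<^esup>\<close> for \<open>m \<ge> 1\<close>.\<close>

definition alternating_product ::
  "('g, 'b) monoid_scheme \<Rightarrow> 'g \<Rightarrow> 'g \<Rightarrow> (nat \<Rightarrow> int) \<Rightarrow> (nat \<Rightarrow> int) \<Rightarrow> nat \<Rightarrow> 'g" where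
  "alternating_product G x y a b m =
     foldr (\<lambda>j z. (x [^]\<^bsub>G\<^esub> a j \<otimes>\<^bsub>G\<^esub> y [^]\<^bsub>G\<^esub> b j) \<otimes>\<^bsub>G\<^esub> z) [1..<m] (x [^]\<^bsub>G\<^esub> a m)"

definition W1 :: "word2 \<Rightarrow> word2 \<Rightarrow> bool" where
  "W1 V W \<longleftrightarrow>
     (\<exists>m a b. m \<ge> 1 \<and> a m \<noteq> 0 \<and> V = alternating_product F2 u_A u_B a b m) \<and>
     (\<exists>m a b. m \<ge> 1 \<and> b m \<noteq> 0 \<and> W = alternating_product F2 u_B u_A b a m)"

definition W2 :: "('g, 'b) monoid_scheme \<Rightarrow> 'g set \<Rightarrow> 'g set \<Rightarrow> word2 \<Rightarrow> word2 \<Rightarrow> bool" where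
  "W2 G GA GB V W \<longleftrightarrow> (\<forall>gA\<in>GA. \<forall>gB\<in>GB. word_at G V gA gB = word_at G W gA gB)"

end

theory Submission
  imports Defs
begin

text \<open>
  Substitution turns the recursion of the words into a recursion of the arguments: since evaluation
  at a pair is a homomorphism, \<open>W\<^sub>A\<^sub>,\<^sub>n(x, y)\<close> is the value of \<open>W\<^sub>A\<^sub>,\<^sub>n\<^sub>-\<^sub>1\<close> at the two commutators
  \<open>[y, x]\<close> and \<open>[x\<^sup>-\<^sup>1, y\<^sup>-\<^sup>1]\<close>, and likewise for \<open>W\<^sub>B\<close> with the same two commutators
  (\<open>word_at_substitution\<close>, \<open>word_at_W_Suc\<close>).
  If \<open>x\<close> and \<open>y\<close> lie in a subgroup \<open>H\<close>, the new arguments lie in its derived subgroup. Hence after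
  \<open>n - 1\<close> steps, starting from \<open>H = G\<close>, both words have become the two orders of multiplying one and
  the same pair from the \<open>(n - 1)\<close>-st derived subgroup. That subgroup is abelian, because its derived
  subgroup is the \<open>n\<close>-th one, which is trivial; so the two products agree, which is (W2)
  (\<open>word_at_W_eq\<close>).

  For (W1), only the last exponent is required to be nonzero and all others may vanish. A word with
  arbitrary zero exponents can represent any element: insert trivial powers between consecutive
  letters. To force a nonzero last exponent, this is applied to \<open>W u\<^sub>A\<^sup>-\<^sup>1\<close>, followed by the
  factor \<open>u\<^sub>A\<^sup>1\<close>, and symmetrically for the word that has to end in \<open>u\<^sub>B\<close>
  (\<open>free_lift_mult_eq_alternating_product\<close>, \<open>free_group_eq_alternating_product\<close>).
\<close>

section \<open>Evaluation of words\<close>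

lemma word_at_closed:
  assumes "group G" "x \<in> carrier G" "y \<in> carrier G"
  shows "word_at G W x y \<in> carrier G"
  unfolding word_at_def
  by (rule free_lift_closed[OF assms(1)]) (auto simp: assms split: gen2.split)

lemma word_at_hom:
  assumes "group G" "x \<in> carrier G" "y \<in> carrier G"
  shows "(\<lambda>W. word_at G W x y) \<in> hom F2 G"
  unfolding word_at_def
  by (rule free_lift_hom[OF assms(1)]) (auto simp: assms split: gen2.split)

lemma word_at_gens:
  assumes "group G" "x \<in> carrier G" "y \<in> carrier G"
  shows "word_at G u_A x y = x" "word_at G u_B x y = y"
proof -
  have "case_gen2 x y g \<in> carrier G" for g
    using assms by (cases g) auto
  then show "word_at G u_A x y = x" "word_at G u_B x y = y"
    unfolding word_at_def by (simp_all add: free_lift_gen[OF assms(1)])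
qed

lemma word_at_substitution:
  assumes G: "group G" "x \<in> carrier G" "y \<in> carrier G"
    and V: "V \<in> carrier F2" and p: "p \<in> carrier F2" and q: "q \<in> carrier F2"
  shows "word_at G (word_at F2 V p q) x y = word_at G V (word_at G p x y) (word_at G q x y)"
proof -
  let ?h = "\<lambda>V. word_at G (word_at F2 V p q) x y"
  have "?h \<in> hom F2 G"
    using hom_compose[OF word_at_hom[OF group_free_group p q] word_at_hom[OF G]]
    by (simp add: o_def)
  then have "?h V = free_lift G (\<lambda>g. ?h (free_gen g)) V"
    by (rule free_lift_unique[OF G(1) _ V])
  also have "(\<lambda>g. ?h (free_gen g)) = case_gen2 (word_at G p x y) (word_at G q x y)"
  proof
    show "?h (free_gen g) = case_gen2 (word_at G p x y) (word_at G q x y) g" for g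
      by (cases g) (simp_all add: word_at_gens[OF group_free_group p q])
  qed
  finally show ?thesis
    by (simp only: word_at_def[of G V])
qed

lemma (in group) commutator_closed:
  "\<lbrakk>g \<in> carrier G; h \<in> carrier G\<rbrakk> \<Longrightarrow> commutator G g h \<in> carrier G"
  by (simp add: commutator_def)

lemma (in group_hom) hom_commutator:
  "\<lbrakk>g \<in> carrier G; h' \<in> carrier G\<rbrakk> \<Longrightarrow> h (commutator G g h') = commutator H (h g) (h h')"
  by (simp add: commutator_def)

lemma word_at_commutators:
  assumes G: "group G" "x \<in> carrier G" "y \<in> carrier G"
  shows "word_at G (commutator F2 u_B u_A) x y = commutator G y x"
    and "word_at G (commutator F2 (inv\<^bsub>F2\<^esub> u_A) (inv\<^bsub>F2\<^esub> u_B)) x y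
       = commutator G (inv\<^bsub>G\<^esub> x) (inv\<^bsub>G\<^esub> y)"
proof -
  interpret F: group "F2"
    by (rule group_free_group)
  interpret group_hom F2 G "\<lambda>W. word_at G W x y"
    using G word_at_hom[OF G] group_free_group by (simp add: group_hom_def group_hom_axioms_def)
  show "word_at G (commutator F2 u_B u_A) x y = commutator G y x"
    by (simp add: hom_commutator word_at_gens[OF G])
  show "word_at G (commutator F2 (inv\<^bsub>F2\<^esub> u_A) (inv\<^bsub>F2\<^esub> u_B)) x y
      = commutator G (inv\<^bsub>G\<^esub> x) (inv\<^bsub>G\<^esub> y)"
    by (simp add: hom_commutator word_at_gens[OF G])
qed

section \<open>The words in a solvable group\<close>

lemma W_closed: "W_A (Suc n) \<in> carrier F2" "W_B (Suc n) \<in> carrier F2"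
proof -
  interpret F: group "F2"
    by (rule group_free_group)
  show "W_A (Suc n) \<in> carrier F2"
    by (cases n) (auto intro!: word_at_closed group_free_group F.commutator_closed)
  show "W_B (Suc n) \<in> carrier F2"
    by (cases n) (auto intro!: word_at_closed group_free_group F.commutator_closed)
qed

lemma word_at_W_Suc:
  assumes G: "group G" "x \<in> carrier G" "y \<in> carrier G"
  shows "word_at G (W_A (Suc (Suc n))) x y
       = word_at G (W_A (Suc n)) (commutator G y x) (commutator G (inv\<^bsub>G\<^esub> x) (inv\<^bsub>G\<^esub> y))"
    and "word_at G (W_B (Suc (Suc n))) x y
       = word_at G (W_B (Suc n)) (commutator G y x) (commutator G (inv\<^bsub>G\<^esub> x) (inv\<^bsub>G\<^esub> y))"
proof -
  interpret F: group "F2"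
    by (rule group_free_group)
  have c: "commutator F2 u_B u_A \<in> carrier F2"
    "commutator F2 (inv\<^bsub>F2\<^esub> u_A) (inv\<^bsub>F2\<^esub> u_B) \<in> carrier F2"
    by (simp_all add: F.commutator_closed)
  show "word_at G (W_A (Suc (Suc n))) x y
      = word_at G (W_A (Suc n)) (commutator G y x) (commutator G (inv\<^bsub>G\<^esub> x) (inv\<^bsub>G\<^esub> y))"
    by (simp add: word_at_substitution[OF G W_closed(1) c] word_at_commutators[OF G])
  show "word_at G (W_B (Suc (Suc n))) x y
      = word_at G (W_B (Suc n)) (commutator G y x) (commutator G (inv\<^bsub>G\<^esub> x) (inv\<^bsub>G\<^esub> y))"
    by (simp add: word_at_substitution[OF G W_closed(2) c] word_at_commutators[OF G])
qed

text \<open>The derived subgroup is generated by the elements \<open>g h g\<^sup>-\<^sup>1 h\<^sup>-\<^sup>1\<close>, which is the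
  present commutator of \<open>g\<^sup>-\<^sup>1\<close> and \<open>h\<^sup>-\<^sup>1\<close>; closure of \<open>H\<close> under inverses reconciles the two.\<close>

lemma (in group) commutator_in_derived:
  assumes "subgroup H G" "g \<in> H" "h \<in> H"
  shows "commutator G g h \<in> derived G H"
proof -
  have "g \<in> carrier G" "h \<in> carrier G"
    using assms subgroup.subset by blast+
  then have "commutator G g h = inv g \<otimes> inv h \<otimes> inv (inv g) \<otimes> inv (inv h)"
    by (simp add: commutator_def)
  moreover have "inv g \<in> H" "inv h \<in> H"
    using assms by (auto intro: subgroup.m_inv_closed)
  ultimately show ?thesis
    unfolding derived_def by (blast intro: generate.incl)
qed

text \<open>The statement is made for an arbitrary subgroup, so that the induction can pass from \<open>H\<close> to its
  derived subgroup, where the commutators substituted into the shorter words lie.\<close>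

lemma word_at_W_eq:
  assumes "group G" and "subgroup H G" "(derived G ^^ Suc n) H = {\<one>\<^bsub>G\<^esub>}" "x \<in> H" "y \<in> H"
  shows "word_at G (W_A (Suc n)) x y = word_at G (W_B (Suc n)) x y"
  using assms(2-)
proof (induction n arbitrary: H x y)
  interpret group G by fact
  case 0
  have xy: "x \<in> carrier G" "y \<in> carrier G"
    using 0 subgroup.subset by blast+
  interpret h: group_hom F2 G "\<lambda>W. word_at G W x y"
    using assms(1) word_at_hom[OF assms(1) xy] group_free_group by (simp add: group_hom_def group_hom_axioms_def)
  have "x \<otimes>\<^bsub>G\<^esub> y \<otimes>\<^bsub>G\<^esub> inv\<^bsub>G\<^esub> x \<otimes>\<^bsub>G\<^esub> inv\<^bsub>G\<^esub> y \<in> derived G H"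
    unfolding derived_def using 0 by (blast intro: generate.incl)
  then have "x \<otimes>\<^bsub>G\<^esub> y \<otimes>\<^bsub>G\<^esub> inv\<^bsub>G\<^esub> x \<otimes>\<^bsub>G\<^esub> inv\<^bsub>G\<^esub> y = \<one>\<^bsub>G\<^esub>"
    using 0 by simp
  then have "x \<otimes>\<^bsub>G\<^esub> y \<otimes>\<^bsub>G\<^esub> inv\<^bsub>G\<^esub> (y \<otimes>\<^bsub>G\<^esub> x) = \<one>\<^bsub>G\<^esub>"
    using xy by (simp add: inv_mult_group m_assoc)
  then have "x \<otimes>\<^bsub>G\<^esub> y = y \<otimes>\<^bsub>G\<^esub> x"
    using xy by (metis inv_equality inv_inv m_closed inv_closed)
  then show ?case
    using xy assms(1) by (simp add: word_at_gens)
next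
  interpret group G by fact
  case (Suc n)
  have xy: "x \<in> carrier G" "y \<in> carrier G"
    using Suc.prems subgroup.subset by blast+
  have "word_at G (W_A (Suc n)) (commutator G y x) (commutator G (inv\<^bsub>G\<^esub> x) (inv\<^bsub>G\<^esub> y))
      = word_at G (W_B (Suc n)) (commutator G y x) (commutator G (inv\<^bsub>G\<^esub> x) (inv\<^bsub>G\<^esub> y))"
  proof (rule Suc.IH)
    show "subgroup (derived G H) G"
      using Suc.prems(1) by (simp add: derived_is_subgroup subgroup.subset)
    show "(derived G ^^ Suc n) (derived G H) = {\<one>\<^bsub>G\<^esub>}"
      using Suc.prems(2) by (simp only: funpow_Suc_right o_def)
  qed (use Suc.prems in \<open>auto intro!: commutator_in_derived intro: subgroup.m_inv_closed\<close>)
  then show ?case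
    using word_at_W_Suc[OF assms(1) xy] by simp
qed

section \<open>Alternating products\<close>

lemma alternating_product_prepend:
  assumes "m \<ge> 1"
  shows "alternating_product G x y (\<lambda>j. if j = 1 then c else a (j - 1))
           (\<lambda>j. if j = 1 then d else b (j - 1)) (Suc m)
       = (x [^]\<^bsub>G\<^esub> (c :: int) \<otimes>\<^bsub>G\<^esub> y [^]\<^bsub>G\<^esub> (d :: int)) \<otimes>\<^bsub>G\<^esub> alternating_product G x y a b m"
proof -
  have "[1..<Suc m] = 1 # map Suc [1..<m]"
    using assms by (simp add: upt_conv_Cons map_Suc_upt del: upt_Suc)
  moreover have "foldr (\<lambda>j. (\<otimes>\<^bsub>G\<^esub>)
        (x [^]\<^bsub>G\<^esub> (if Suc j = 1 then c else a (Suc j - 1)) \<otimes>\<^bsub>G\<^esub>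
         y [^]\<^bsub>G\<^esub> (if Suc j = 1 then d else b (Suc j - 1)))) [1..<m] z
      = foldr (\<lambda>j. (\<otimes>\<^bsub>G\<^esub>) (x [^]\<^bsub>G\<^esub> a j \<otimes>\<^bsub>G\<^esub> y [^]\<^bsub>G\<^esub> b j)) [1..<m] z" for z
    by (rule foldr_cong) auto
  ultimately show ?thesis
    using assms by (simp add: alternating_product_def foldr_map o_def del: upt_Suc)
qed

text \<open>Each letter of \<open>w\<close> contributes one block \<open>x\<^sup>c y\<^sup>d\<close> in which one of the two exponents is
  zero; the trailing factor \<open>x\<close> provides the nonzero last exponent.\<close>

lemma free_lift_mult_eq_alternating_product:
  assumes "group G" and xy: "x \<in> carrier G" "y \<in> carrier G" and f: "\<And>g. f g \<in> {x, y}"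
  shows "\<exists>m a b. m \<ge> 1 \<and> a m \<noteq> 0 \<and> free_lift G f w \<otimes>\<^bsub>G\<^esub> x = alternating_product G x y a b m"
proof (induction w)
  interpret group G by fact
  case Nil
  have "free_lift G f [] \<otimes>\<^bsub>G\<^esub> x = alternating_product G x y (\<lambda>_. 1) (\<lambda>_. 0) 1"
    using xy by (simp add: free_lift_def alternating_product_def int_pow_1)
  then show ?case
    by (intro exI[of _ 1] exI[of _ "\<lambda>_. 1"] exI[of _ "\<lambda>_. 0"]) simp
next
  interpret group G by fact
  case (Cons l w)
  obtain m a b where m: "m \<ge> 1" "a m \<noteq> 0"
    and w: "free_lift G f w \<otimes>\<^bsub>G\<^esub> x = alternating_product G x y a b m"
    using Cons by blast
  obtain g e where l: "l = (g, e)"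
    by (cases l)
  have fc: "f h \<in> carrier G" for h
    using f[of h] xy by auto
  have cl: "free_lift G f w \<in> carrier G"
    by (rule free_lift_closed[OF assms(1) fc])
  define s :: int where "s = (if e then 1 else -1)"
  define c where "c = (if f g = x then s else 0)"
  define d where "d = (if f g = x then 0 else s)"
  have "x [^]\<^bsub>G\<^esub> c \<otimes>\<^bsub>G\<^esub> y [^]\<^bsub>G\<^esub> d = (if e then f g else inv\<^bsub>G\<^esub> (f g))"
    using f[of g] xy by (auto simp: c_def d_def s_def int_pow_neg int_pow_1)
  then have "free_lift G f (l # w) \<otimes>\<^bsub>G\<^esub> x
      = (x [^]\<^bsub>G\<^esub> c \<otimes>\<^bsub>G\<^esub> y [^]\<^bsub>G\<^esub> d) \<otimes>\<^bsub>G\<^esub> (free_lift G f w \<otimes>\<^bsub>G\<^esub> x)"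
    using xy cl fc by (simp add: l free_lift_def m_assoc)
  also have "\<dots> = alternating_product G x y (\<lambda>j. if j = 1 then c else a (j - 1))
      (\<lambda>j. if j = 1 then d else b (j - 1)) (Suc m)"
    unfolding w by (rule alternating_product_prepend[OF m(1), symmetric])
  finally show ?case
    using m by (intro exI conjI) auto
qed

lemma free_group_eq_alternating_product:
  assumes V: "V \<in> carrier free_group" and gens: "\<And>g. g \<in> {s, t}"
  shows "\<exists>m a b. m \<ge> 1 \<and> a m \<noteq> 0
    \<and> V = alternating_product free_group (free_gen s) (free_gen t) a b m"
proof -
  interpret F: group free_group
    by (rule group_free_group)
  define V' where "V' = V \<otimes>\<^bsub>free_group\<^esub> inv\<^bsub>free_group\<^esub> (free_gen s)"
  have V': "V' \<in> carrier free_group"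
    using V by (simp add: V'_def)
  have "V = V' \<otimes>\<^bsub>free_group\<^esub> free_gen s"
    using V by (simp add: V'_def F.m_assoc)
  moreover have "V' = free_lift free_group free_gen V'"
    using free_lift_unique[OF group_free_group _ V', of id] by (simp add: hom_def)
  moreover have "free_gen g \<in> {free_gen s, free_gen t}" for g
    using gens[of g] by auto
  ultimately show ?thesis
    using free_lift_mult_eq_alternating_product
      [OF group_free_group, of "free_gen s" "free_gen t" free_gen V'] by simp
qed

lemma W1_of_carrier:
  assumes "V \<in> carrier F2" "W \<in> carrier F2"
  shows "W1 V W"
proof -
  have g: "g \<in> {GenA, GenB}" "g \<in> {GenB, GenA}" for g
    by (cases g; simp)+
  show ?thesis
    using free_group_eq_alternating_product[OF assms(1) g(1)]
      free_group_eq_alternating_product[OF assms(2) g(2)]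
    unfolding W1_def by blast
qed

theorem mainTheorem1:
  fixes G :: "('g, 'b) monoid_scheme" and n :: nat
  assumes "n \<ge> 1"
    and "group G"
    and "solvable G"
    and "(derived G ^^ n) (carrier G) = {\<one>\<^bsub>G\<^esub>}"
  shows "W1 (W_A n) (W_B n) \<and> W2 G (carrier G) (carrier G) (W_A n) (W_B n)"
proof -
  obtain k where n: "n = Suc k"
    using assms(1) by (cases n) auto
  have "W1 (W_A n) (W_B n)"
    unfolding n by (intro W1_of_carrier W_closed)
  moreover have "W2 G (carrier G) (carrier G) (W_A n) (W_B n)"
    using assms word_at_W_eq[OF assms(2) group.subgroup_self[OF assms(2)]]
    unfolding n W2_def by blast
  ultimately show ?thesis ..
qed

end
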